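(* Let $0<q<1$, $0<a<q^{-1}$, $0<b<q^{-1}$, $c<0$ and $n\in\mathbb{N}$. Then for all $x$, $$\sum_{k=0}^n\frac{(q^{-n},x;q)_k}{(q,aq,cq;q)_k}(ab)^kq^{k(k+n+1)}\,P_{n-k}(xq^k;aq^k,bq^k,cq^k;q)=P_n(x;a,0,c;q).$$
   Context: $\mathbb N=\{0,1,2,\dots\}$. $(y;q)_k=\prod_{j=0}^{k-1}(1-yq^j)$ and $(y_1,\dots,y_r;q)_k=\prod_i(y_i;q)_k$. The big $q$-Jacobi polynomials are $$P_n(x;a,b,c;q)=\sum_{j=0}^n\frac{(q^{-n},abq^{n+1},x;q)_j}{(aq,cq,q;q)_j}q^j;$$ the case $b=0$ gives the big $q$-Laguerre polynomials. *)

theory Defs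
  imports Complex_Main
begin

definition qpoch :: "'a::field \<Rightarrow> 'a \<Rightarrow> nat \<Rightarrow> 'a" where
  "qpoch y q k = (\<Prod>j<k. 1 - y * q ^ j)"

definition qpochs :: "'a::field list \<Rightarrow> 'a \<Rightarrow> nat \<Rightarrow> 'a" where
  "qpochs ys q k = (\<Prod>y\<leftarrow>ys. qpoch y q k)"

definition big_q_jacobi :: "nat \<Rightarrow> 'a::field \<Rightarrow> 'a \<Rightarrow> 'a \<Rightarrow> 'a \<Rightarrow> 'a \<Rightarrow> 'a" where
  "big_q_jacobi n x a b c q =
     (\<Sum>j\<le>n. qpochs [q powi (- int n), a * b * q ^ (n + 1), x] q j
            / qpochs [a * q, c * q, q] q j * q ^ j)"

end

theory Submission
  imports Defs
begin

text \<open>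
  The factors of the outer and the inner sum telescope: with \<open>m = k + j\<close> one has
  \<open>(y;q)\<^sub>k (y q\<^sup>k;q)\<^sub>j = (y;q)\<^sub>m\<close> for \<open>y = q\<^sup>-\<^sup>n, x, aq, cq\<close>. Summing over the
  diagonals \<open>k + j = m\<close> therefore gives the expansion of \<open>P\<^sub>n(x;a,0,c;q)\<close>, where the coefficient
  of index \<open>m\<close> is multiplied by the sum over \<open>k\<close> of
  \<open>qbinom(m,k) z\<^sup>k q^(k(k-1)) (z q\<^sup>k;q)\<^sub>m\<^sub>-\<^sub>k\<close> with \<open>z = a b q^(n+1)\<close>.
  This sum equals 1 for every \<open>z\<close> (lemma \<open>q_binomial_partition_of_unity\<close>): the \<open>q\<close>-Pascal
  rule turns the sum for \<open>m + 1\<close> at \<open>z\<close> into the sum for \<open>m\<close> at \<open>z q\<close>.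

  The argument is purely algebraic and takes place over any field in which no positive power of
  \<open>q \<noteq> 0\<close> is 1; for \<open>0 < q < 1\<close> this is clear.
\<close>

lemma qpoch_0 [simp]: "qpoch y q 0 = 1"
  by (simp add: qpoch_def)

lemma qpoch_Suc: "qpoch y q (Suc k) = qpoch y q k * (1 - y * q ^ k)"
  by (simp add: qpoch_def)

lemma qpoch_zero [simp]: "qpoch 0 q k = 1"
  by (simp add: qpoch_def)

lemma qpoch_add: "qpoch y q (k + j) = qpoch y q k * qpoch (y * q ^ k) q j"
  by (induction j) (simp_all add: qpoch_Suc power_add mult.assoc)

lemma qpoch_split:
  "k \<le> m \<Longrightarrow> qpoch y q m = qpoch y q k * qpoch (y * q ^ k) q (m - k)"
  using qpoch_add[of y q k "m - k"] by simp

lemma qpoch_Suc_left: "qpoch y q (Suc k) = (1 - y) * qpoch (y * q) q k"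
  using qpoch_add[of y q 1 k] by (simp add: qpoch_Suc)

lemma qpoch_self_Suc: "qpoch q q (Suc k) = qpoch q q k * (1 - q ^ Suc k)"
  by (simp add: qpoch_Suc)

text \<open>
  The summation form of the \<open>q\<close>-Pascal rule
  \<open>qbinom(m+1,k) = qbinom(m,k-1) + q\<^sup>k qbinom(m,k)\<close>, with \<open>qbinom(m,k)/(q;q)\<^sub>m\<close> in place of
  \<open>qbinom(m,k)\<close>.  It rests on \<open>1 - q^(m+1) = (1 - q\<^sup>k) + q\<^sup>k (1 - q^(m+1-k))\<close>, where each
  summand cancels the last factor of one of the two \<open>q\<close>-factorials in the denominator.
\<close>
lemma q_pascal_sum:
  fixes q :: "'a::field"
  assumes nz: "\<And>k. qpoch q q k \<noteq> 0"
  shows "(1 - q ^ Suc m) * (\<Sum>k\<le>Suc m. f k / (qpoch q q k * qpoch q q (Suc m - k)))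
       = (\<Sum>k\<le>m. (f (Suc k) + q ^ k * f k) / (qpoch q q k * qpoch q q (m - k)))"
proof -
  define w where "w m k = qpoch q q k * qpoch q q (m - k)" for m k
  have nz': "1 - q ^ Suc k \<noteq> 0" for k
    using nz[of "Suc k"] unfolding qpoch_self_Suc by simp
  have cancel: "d * e / (u * d * v) = e / (u * v)" if "d \<noteq> 0" for d e u v :: 'a
    using that by simp
  have lo: "(1 - q ^ Suc k) * f (Suc k) / w (Suc m) (Suc k) = f (Suc k) / w m k" for k
    unfolding w_def qpoch_self_Suc diff_Suc_Suc
    using cancel[OF nz', of k "f (Suc k)" "qpoch q q k" "qpoch q q (m - k)"] by simp
  have hi: "q ^ k * (1 - q ^ (Suc m - k)) * f k / w (Suc m) k = q ^ k * f k / w m k"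
    if "k \<le> m" for k
    unfolding w_def Suc_diff_le[OF that] qpoch_self_Suc
    using cancel[OF nz', of "m - k" "q ^ k * f k" "qpoch q q (m - k)" "qpoch q q k"]
    by (simp only: mult_ac)
  have "(1 - q ^ Suc m) * (\<Sum>k\<le>Suc m. f k / w (Suc m) k)
      = (\<Sum>k\<le>Suc m. (1 - q ^ k) * f k / w (Suc m) k
          + q ^ k * (1 - q ^ (Suc m - k)) * f k / w (Suc m) k)"
    unfolding sum_distrib_left
  proof (rule sum.cong[OF refl])
    fix k assume "k \<in> {..Suc m}"
    then have "q ^ k * q ^ (Suc m - k) = q ^ Suc m"
      by (simp flip: power_add)
    then have "1 - q ^ Suc m = (1 - q ^ k) + q ^ k * (1 - q ^ (Suc m - k))"
      by (simp add: right_diff_distrib)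
    then show "(1 - q ^ Suc m) * (f k / w (Suc m) k) = (1 - q ^ k) * f k / w (Suc m) k
          + q ^ k * (1 - q ^ (Suc m - k)) * f k / w (Suc m) k"
      by (simp only: distrib_right add_divide_distrib times_divide_eq_right)
  qed
  also have "\<dots> = (\<Sum>k\<le>Suc m. (1 - q ^ k) * f k / w (Suc m) k)
      + (\<Sum>k\<le>Suc m. q ^ k * (1 - q ^ (Suc m - k)) * f k / w (Suc m) k)"
    by (rule sum.distrib)
  also have "(\<Sum>k\<le>Suc m. (1 - q ^ k) * f k / w (Suc m) k) = (\<Sum>k\<le>m. f (Suc k) / w m k)"
    unfolding sum.atMost_Suc_shift lo by simp
  also have "(\<Sum>k\<le>Suc m. q ^ k * (1 - q ^ (Suc m - k)) * f k / w (Suc m) k)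
      = (\<Sum>k\<le>m. q ^ k * f k / w m k)"
    using hi by simp
  finally show ?thesis
    by (simp only: w_def add_divide_distrib sum.distrib)
qed

text \<open>
  After the \<open>q\<close>-Pascal rule the two contributions to the index \<open>k\<close> carry the factors \<open>z q\<^sup>k\<close> and
  \<open>1 - z q\<^sup>k\<close>, which add up to 1. What remains is the same sum for \<open>m\<close> at \<open>z q\<close>, so the induction
  has to be over all \<open>z\<close>.
\<close>
lemma q_binomial_partition_of_unity:
  fixes q :: "'a::field"
  assumes nz: "\<And>k. qpoch q q k \<noteq> 0"
  shows "(\<Sum>k\<le>m. z ^ k * q ^ (k * (k - 1)) * qpoch (z * q ^ k) q (m - k)
            / (qpoch q q k * qpoch q q (m - k))) = 1 / qpoch q q m"
proof (induction m arbitrary: z)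
  case 0
  then show ?case by simp
next
  case (Suc m)
  define f where "f k = z ^ k * q ^ (k * (k - 1)) * qpoch (z * q ^ k) q (Suc m - k)" for k
  define g where "g k = (z * q) ^ k * q ^ (k * (k - 1)) * qpoch (z * q * q ^ k) q (m - k)" for k
  have step: "f (Suc k) + q ^ k * f k = g k" if "k \<le> m" for k
  proof -
    have exponent: "q ^ (Suc k * (Suc k - 1)) = q ^ k * q ^ k * q ^ (k * (k - 1))"
      by (cases k) (simp_all flip: power_add add: algebra_simps)
    have 1: "f (Suc k) = z * q ^ k * g k"
      unfolding f_def g_def exponent by (simp add: power_mult_distrib mult_ac)
    have 2: "q ^ k * f k = (1 - z * q ^ k) * g k"
      unfolding f_def g_def Suc_diff_le[OF that] qpoch_Suc_left
      by (simp add: power_mult_distrib mult_ac)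
    show ?thesis
      unfolding 1 2 by (simp add: left_diff_distrib)
  qed
  have "(1 - q ^ Suc m) * (\<Sum>k\<le>Suc m. f k / (qpoch q q k * qpoch q q (Suc m - k)))
      = (\<Sum>k\<le>m. g k / (qpoch q q k * qpoch q q (m - k)))"
    unfolding q_pascal_sum[OF nz] by (rule sum.cong) (simp_all add: step)
  also have "\<dots> = 1 / qpoch q q m"
    unfolding g_def by (rule Suc.IH)
  finally have *: "(1 - q ^ Suc m) * (\<Sum>k\<le>Suc m. f k / (qpoch q q k * qpoch q q (Suc m - k)))
      = 1 / qpoch q q m" .
  have "1 - q ^ Suc m \<noteq> 0"
    using nz[of "Suc m"] unfolding qpoch_self_Suc by simp
  with * nz show ?case
    unfolding f_def[symmetric] qpoch_self_Suc by (simp add: field_simps del: power_Suc sum.atMost_Suc)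
qed

lemma sum_triangle_diagonals:
  fixes g :: "nat \<Rightarrow> nat \<Rightarrow> 'a::comm_monoid_add"
  shows "(\<Sum>k\<le>n. \<Sum>j\<le>n - k. g k j) = (\<Sum>m\<le>n. \<Sum>k\<le>m. g k (m - k))"
proof -
  have "(SIGMA k:{..n}. {..n - k}) = {(k, j). k + j \<le> n}"
    by auto
  then show ?thesis
    by (simp add: sum.Sigma sum.triangle_reindex_eq)
qed

text \<open>
  The identity over an arbitrary field. In the summand of index \<open>(k, m - k)\<close> everything except the
  term of \<open>q_binomial_partition_of_unity\<close> at \<open>z = a b q^(n+1)\<close> depends on \<open>m\<close> only.
\<close>
lemma big_q_jacobi_sum_eq_big_q_laguerre:
  fixes q a b c x :: "'a::field"
  assumes "q \<noteq> 0" and nz: "\<And>k. qpoch q q k \<noteq> 0"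
  shows "(\<Sum>k\<le>n. qpochs [q powi (- int n), x] q k / qpochs [q, a * q, c * q] q k
            * (a * b) ^ k * q ^ (k * (k + n + 1))
            * big_q_jacobi (n - k) (x * q ^ k) (a * q ^ k) (b * q ^ k) (c * q ^ k) q)
       = big_q_jacobi n x a 0 c q"
proof -
  define z where "z = a * b * q ^ (n + 1)"
  define t where "t m k = z ^ k * q ^ (k * (k - 1)) * qpoch (z * q ^ k) q (m - k)
      / (qpoch q q k * qpoch q q (m - k))" for m k
  define C where "C m = qpoch (q powi (- int n)) q m * qpoch x q m
      / (qpoch (a * q) q m * qpoch (c * q) q m) * q ^ m" for m
  define g where "g k j = qpochs [q powi (- int n), x] q k / qpochs [q, a * q, c * q] q k
            * (a * b) ^ k * q ^ (k * (k + n + 1)) *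
       (qpochs [q powi (- int (n - k)), a * q ^ k * (b * q ^ k) * q ^ (n - k + 1), x * q ^ k] q j
            / qpochs [a * q ^ k * q, c * q ^ k * q, q] q j * q ^ j)" for k j
  have summand: "g k (m - k) = C m * t m k" if "k \<le> m" "m \<le> n" for m k
  proof -
    have kn: "k \<le> n" using that by simp
    have neg_pow: "q powi (- int (n - k)) = q powi (- int n) * q ^ k"
      using \<open>q \<noteq> 0\<close> kn by (simp add: of_nat_diff power_int_diff power_int_minus field_simps)
    have "q ^ k * q ^ k * q ^ (n - k + 1) = q ^ (n + 1) * q ^ k"
      using kn by (simp add: add.commute flip: power_add power_Suc power_Suc2)
    then have z_shift: "a * q ^ k * (b * q ^ k) * q ^ (n - k + 1) = z * q ^ k"
      unfolding z_def by (metis (no_types, lifting) mult.assoc mult.commute)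
    \<comment> \<open>The factor \<open>q ^ (m - k)\<close> of the inner sum is what lowers the exponent \<open>k\<^sup>2\<close> to \<open>k(k-1)\<close>.\<close>
    have exponent: "k * (k + n + 1) + (m - k) = (n + 1) * k + k * (k - 1) + m"
      using that by (cases k) (simp_all add: algebra_simps)
    have powers: "(a * b) ^ k * (q ^ (k * (k + n + 1)) * q ^ (m - k))
        = z ^ k * q ^ (k * (k - 1)) * q ^ m"
      unfolding power_add[symmetric] exponent z_def
      by (simp only: power_add power_mult power_mult_distrib mult.assoc)
    have "g k (m - k) =
        (qpoch (q powi (- int n)) q k * qpoch (q powi (- int n) * q ^ k) q (m - k))
        * (qpoch x q k * qpoch (x * q ^ k) q (m - k))
        / ((qpoch (a * q) q k * qpoch (a * q * q ^ k) q (m - k))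
          * (qpoch (c * q) q k * qpoch (c * q * q ^ k) q (m - k)))
        * ((a * b) ^ k * (q ^ (k * (k + n + 1)) * q ^ (m - k)))
        * qpoch (z * q ^ k) q (m - k) / (qpoch q q k * qpoch q q (m - k))"
      unfolding g_def qpochs_def neg_pow z_shift
      by (simp add: divide_inverse mult_ac)
    also have "\<dots> = C m * t m k"
      unfolding qpoch_split[OF that(1), symmetric] powers
      by (simp add: C_def t_def divide_inverse mult_ac)
    finally show ?thesis .
  qed
  have "(\<Sum>k\<le>n. qpochs [q powi (- int n), x] q k / qpochs [q, a * q, c * q] q k
            * (a * b) ^ k * q ^ (k * (k + n + 1))
            * big_q_jacobi (n - k) (x * q ^ k) (a * q ^ k) (b * q ^ k) (c * q ^ k) q)
      = (\<Sum>k\<le>n. \<Sum>j\<le>n - k. g k j)"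
    unfolding big_q_jacobi_def g_def sum_distrib_left ..
  also have "\<dots> = (\<Sum>m\<le>n. \<Sum>k\<le>m. g k (m - k))"
    by (rule sum_triangle_diagonals)
  also have "\<dots> = (\<Sum>m\<le>n. C m * (\<Sum>k\<le>m. t m k))"
    unfolding sum_distrib_left by (intro sum.cong refl summand) auto
  also have "\<dots> = (\<Sum>m\<le>n. C m * (1 / qpoch q q m))"
    unfolding t_def q_binomial_partition_of_unity[OF nz] ..
  also have "\<dots> = big_q_jacobi n x a 0 c q"
    unfolding big_q_jacobi_def C_def
    by (intro sum.cong refl) (simp add: qpochs_def divide_inverse mult_ac)
  finally show ?thesis .
qed

theorem mainTheorem14:
  fixes q a b c :: real and n :: nat and x :: complex
  assumes "0 < q" and "q < 1"
    and "0 < a" and "a < inverse q"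
    and "0 < b" and "b < inverse q"
    and "c < 0"
  shows "(let Q = complex_of_real q; A = complex_of_real a;
              B = complex_of_real b; C = complex_of_real c
          in (\<Sum>k\<le>n. qpochs [Q powi (- int n), x] Q k / qpochs [Q, A * Q, C * Q] Q k
                * (A * B) ^ k * Q ^ (k * (k + n + 1))
                * big_q_jacobi (n - k) (x * Q ^ k) (A * Q ^ k) (B * Q ^ k) (C * Q ^ k) Q)
             = big_q_jacobi n x A 0 C Q)"
proof -
  have "qpoch (complex_of_real q) (complex_of_real q) k \<noteq> 0" for k
  proof (induction k)
    case (Suc k)
    have "q ^ Suc k \<noteq> 1"
      using power_Suc_less_one[OF \<open>0 < q\<close> \<open>q < 1\<close>, of k] by simp
    then have "complex_of_real q ^ Suc k \<noteq> 1"
      by (metis of_real_power of_real_eq_1_iff)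
    then show ?case
      using Suc.IH unfolding qpoch_self_Suc by simp
  qed simp
  then show ?thesis
    unfolding Let_def using \<open>0 < q\<close> by (intro big_q_jacobi_sum_eq_big_q_laguerre) simp_all
qed

end
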